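(* Let $G$ be a finite simple graph on vertex set $[n]=\{1,\dots,n\}$, and let $\boldsymbol{p}=(p_1,\dots,p_n)\in[0,1)^n$. (i) If $Z_G(-\boldsymbol{p};S)>0$ for every $S\subseteq[n]$, and $f:\{0,1\}^n\to\mathbb{R}_{\ge0}$ is a supermodular function with $f(\boldsymbol{0})>0$ that factorizes according to $\boldsymbol{p},G$, then for every $\boldsymbol{x}\in\{0,1\}^n$, $$f(\boldsymbol{x})\ge f(\boldsymbol{0})\cdot Z_G(-p_1x_1,-p_2x_2,\dots,-p_nx_n)>0.$$ (ii) If $Z_G(-\boldsymbol{p};S)<0$ for some $S\subseteq[n]$, then there exists a supermodular function $f:\{0,1\}^n\to\mathbb{R}_{\ge0}$ with $f(\boldsymbol{0})>0$ that factorizes according to $\boldsymbol{p},G$, such that $f(\boldsymbol{x})=0$ for some $\boldsymbol{x}\in\{0,1\}^n$.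
   Context: $\Gamma_i$ denotes the set of neighbors of vertex $i$ in $G$. The independent set polynomial of $G$ is $Z_G(x_1,\dots,x_n)=\sum_{I\in\mathrm{Ind}(G)}\prod_{i\in I}x_i$, where $\mathrm{Ind}(G)$ is the set of all independent sets of $G$ (including $\emptyset$). For $S\subseteq[n]$, $Z_G(\boldsymbol{x};S)$ denotes the value of $Z_G$ when all variables outside $S$ are set to $0$, i.e. $Z_G(\boldsymbol{x};S)=\sum_{I\in\mathrm{Ind}(G),\,I\subseteq S}\prod_{i\in I}x_i$. A function $f:\{0,1\}^n\to\mathbb{R}_{\ge0}$ is also regarded as a function on subsets of $[n]$ by identifying $\boldsymbol{x}\in\{0,1\}^n$ with the set having characteristic vector $\boldsymbol{x}$; thus $f(\emptyset)=f(\boldsymbol{0})$. For $i\in[n]$ and $S\subseteq[n]\setminus\{i\}$, $\Delta_if(S)=f(S\cup\{i\})-f(S)$. $f$ is supermodular if for every $i\in[n]$, $\Delta_if(S)\le\Delta_if(T)$ whenever $S\subseteq T\subseteq[n]\setminus\{i\}$. $f$ factorizes according to $\boldsymbol{p},G$ if $f(S\cup\{i\})\ge(1-p_i)f(S)$ for all $i\in[n]$ and all $S\subseteq[n]\setminus(\Gamma_i\cup\{i\})$. *)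

theory Defs
  imports Complex_Main "HOL-Library.FuncSet" "HOL-Library.Indicator_Function"
begin

definition simple_graph :: "'a set \<Rightarrow> 'a set set \<Rightarrow> bool" where
  "simple_graph V E \<longleftrightarrow> finite V \<and> (\<forall>e\<in>E. e \<subseteq> V \<and> card e = 2)"

definition neighbors :: "'a set set \<Rightarrow> 'a \<Rightarrow> 'a set" where
  "neighbors E i = {j. {i, j} \<in> E}"

definition indep_sets :: "'a set \<Rightarrow> 'a set set \<Rightarrow> 'a set set" where
  "indep_sets V E = {I. I \<subseteq> V \<and> (\<forall>i\<in>I. \<forall>j\<in>I. {i, j} \<notin> E)}"

text \<open>The multivariate polynomial \<open>Z\<^sub>G\<close> is represented by its evaluation at the point \<open>x\<close>;
  only the coordinates of \<open>x\<close> in the vertex set matter.\<close>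

definition indep_poly :: "'a set \<Rightarrow> 'a set set \<Rightarrow> ('a \<Rightarrow> real) \<Rightarrow> real" where
  "indep_poly V E x = (\<Sum>I\<in>indep_sets V E. \<Prod>i\<in>I. x i)"

text \<open>\<open>Z\<^sub>G(x; S)\<close>: the variables outside \<open>S\<close> are set to zero.\<close>

definition indep_poly_on :: "'a set \<Rightarrow> 'a set set \<Rightarrow> ('a \<Rightarrow> real) \<Rightarrow> 'a set \<Rightarrow> real" where
  "indep_poly_on V E x S = (\<Sum>I\<in>{I \<in> indep_sets V E. I \<subseteq> S}. \<Prod>i\<in>I. x i)"

definition cube :: "'a set \<Rightarrow> ('a \<Rightarrow> real) set" where
  "cube V = V \<rightarrow>\<^sub>E {0, 1}"

definition char_vec :: "'a set \<Rightarrow> 'a set \<Rightarrow> 'a \<Rightarrow> real" where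
  "char_vec V S = restrict (indicator S) V"

definition set_fun :: "'a set \<Rightarrow> (('a \<Rightarrow> real) \<Rightarrow> real) \<Rightarrow> 'a set \<Rightarrow> real" where
  "set_fun V f S = f (char_vec V S)"

definition marginal :: "('a set \<Rightarrow> real) \<Rightarrow> 'a \<Rightarrow> 'a set \<Rightarrow> real" where
  "marginal F i S = F (S \<union> {i}) - F S"

definition supermodular :: "'a set \<Rightarrow> (('a \<Rightarrow> real) \<Rightarrow> real) \<Rightarrow> bool" where
  "supermodular V f \<longleftrightarrow>
    (\<forall>i\<in>V. \<forall>S T. S \<subseteq> T \<and> T \<subseteq> V - {i} \<longrightarrow>
      marginal (set_fun V f) i S \<le> marginal (set_fun V f) i T)"

definition factorizes :: "'a set \<Rightarrow> 'a set set \<Rightarrow> ('a \<Rightarrow> real) \<Rightarrow> (('a \<Rightarrow> real) \<Rightarrow> real) \<Rightarrow> bool" where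
  "factorizes V E p f \<longleftrightarrow>
    (\<forall>i\<in>V. \<forall>S. S \<subseteq> V - (neighbors E i \<union> {i}) \<longrightarrow>
      set_fun V f (S \<union> {i}) \<ge> (1 - p i) * set_fun V f S)"

end

theory Submission
  imports Defs
begin

text \<open>
  For a vertex \<open>i \<notin> S\<close> with neighbourhood \<open>\<Gamma>\<^sub>i\<close>, the polynomial satisfies
  \<open>Z(x; S \<union> {i}) = Z(x; S) + x\<^sub>i Z(x; S - \<Gamma>\<^sub>i)\<close>.

  (i) Supermodularity and factorization give \<open>f(S \<union> {i}) \<ge> f(S) - p\<^sub>i f(S - \<Gamma>\<^sub>i)\<close>, so by induction
  the ratio of \<open>f\<close> to \<open>Z(-p; _)\<close> is monotone; it is stated in cross-multiplied form to avoid
  dividing.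

  (ii) The minimum of \<open>Z(-tp; S)\<close> over all \<open>S\<close> is continuous in \<open>t\<close>, equals \<open>1\<close> at
  \<open>t = 0\<close> and is negative at \<open>t = 1\<close>. At a zero \<open>t\<close> of it the function \<open>S \<mapsto> Z(-tp; S)\<close> itself is
  the required \<open>f\<close>: by the recurrence, being nonnegative makes it decreasing, and this in turn makes
  it supermodular.
\<close>

section \<open>Independence polynomials: vertex recurrence and restriction of variables\<close>

lemma finite_indep_sets: "finite V \<Longrightarrow> finite (indep_sets V E)"
  by (rule finite_subset[of _ "Pow V"]) (auto simp: indep_sets_def)

lemma indep_poly_on_empty [simp]: "indep_poly_on V E x {} = 1"
proof -
  have "{I \<in> indep_sets V E. I \<subseteq> {}} = {{}}"
    by (auto simp: indep_sets_def)
  then show ?thesis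
    by (simp add: indep_poly_on_def)
qed

text \<open>Split the independent subsets of \<open>insert i S\<close> by membership of
  \<open>i\<close>: removing \<open>i\<close> from those that contain it gives exactly the
  independent subsets of \<open>S - neighbors E i\<close>.\<close>

lemma indep_poly_on_insert:
  assumes G: "simple_graph V E" and i: "i \<in> V" "i \<notin> S"
  shows "indep_poly_on V E x (insert i S) =
    indep_poly_on V E x S + x i * indep_poly_on V E x (S - neighbors E i)"
proof -
  let ?A = "\<lambda>S. {I \<in> indep_sets V E. I \<subseteq> S}"
  have fin: "finite (?A T)" for T
    using G by (simp add: simple_graph_def finite_indep_sets)
  \<comment> \<open>The definition of \<open>indep_sets\<close> also tests \<open>i = j\<close>, so
    the added vertex must be checked against itself.\<close>
  have loop: "{j} \<notin> E" for j
    using G by (auto simp: simple_graph_def)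
  have split: "?A (insert i S) = ?A S \<union> insert i ` ?A (S - neighbors E i)"
  proof (intro equalityI subsetI)
    fix I assume I: "I \<in> ?A (insert i S)"
    show "I \<in> ?A S \<union> insert i ` ?A (S - neighbors E i)"
    proof (cases "i \<in> I")
      case True
      then have "I = insert i (I - {i})" "I - {i} \<in> ?A (S - neighbors E i)"
        using I by (auto simp: indep_sets_def neighbors_def)
      then show ?thesis by blast
    qed (use I in auto)
  next
    fix I assume "I \<in> ?A S \<union> insert i ` ?A (S - neighbors E i)"
    then show "I \<in> ?A (insert i S)"
      using i loop by (fastforce simp: indep_sets_def neighbors_def insert_commute)
  qed
  have inj: "inj_on (insert i) (?A (S - neighbors E i))"
    using i by (intro inj_onI) (auto simp: set_eq_iff)
  have prod: "(\<Prod>j\<in>insert i I. x j) = x i * (\<Prod>j\<in>I. x j)" if "I \<in> ?A (S - neighbors E i)" for I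
  proof (rule prod.insert)
    show "finite I"
      using that G by (auto simp: indep_sets_def simple_graph_def dest: finite_subset)
    show "i \<notin> I"
      using that i by auto
  qed
  have "indep_poly_on V E x (insert i S) = indep_poly_on V E x S
      + (\<Sum>I\<in>insert i ` ?A (S - neighbors E i). \<Prod>j\<in>I. x j)"
    unfolding indep_poly_on_def split using fin i by (intro sum.union_disjoint) auto
  also have "(\<Sum>I\<in>insert i ` ?A (S - neighbors E i). \<Prod>j\<in>I. x j)
      = x i * indep_poly_on V E x (S - neighbors E i)"
    unfolding sum.reindex[OF inj] indep_poly_on_def sum_distrib_left o_def
    by (rule sum.cong[OF refl prod])
  finally show ?thesis .
qed

text \<open>A product over an independent set not inside \<open>S\<close> has a zero factor. This
  links the evaluations in the theorem to the form used by the recurrence.\<close>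

lemma indep_poly_indicator:
  assumes V: "finite V" and x: "\<And>i. i \<in> V \<Longrightarrow> y i = x i * indicator S i"
  shows "indep_poly V E y = indep_poly_on V E x S"
  unfolding indep_poly_def indep_poly_on_def
proof (rule sum.mono_neutral_cong_right)
  show "finite (indep_sets V E)"
    using V by (rule finite_indep_sets)
next
  show "\<forall>I\<in>indep_sets V E - {I \<in> indep_sets V E. I \<subseteq> S}. (\<Prod>i\<in>I. y i) = 0"
  proof
    fix I assume I: "I \<in> indep_sets V E - {I \<in> indep_sets V E. I \<subseteq> S}"
    then obtain j where j: "j \<in> I" "j \<notin> S" by auto
    have IV: "I \<subseteq> V"
      using I by (auto simp: indep_sets_def)
    then have "y j = 0"
      using x[of j] j by auto
    then show "(\<Prod>i\<in>I. y i) = 0"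
      using j IV V by (intro prod_zero) (auto dest: finite_subset)
  qed
next
  fix I assume "I \<in> {I \<in> indep_sets V E. I \<subseteq> S}"
  then show "(\<Prod>i\<in>I. y i) = (\<Prod>i\<in>I. x i)"
    by (intro prod.cong refl) (subst x, auto simp: indep_sets_def)
qed auto

section \<open>Points of the cube as subsets\<close>

lemma char_vec_in_cube: "char_vec V S \<in> cube V"
  by (auto simp: char_vec_def cube_def indicator_def)

lemma cube_eq_char_vec:
  assumes "x \<in> cube V"
  obtains S where "S \<subseteq> V" "x = char_vec V S"
proof
  show "x = char_vec V {i \<in> V. x i = 1}"
  proof
    fix i
    have "x i = (if i \<in> V then if x i = 1 then 1 else 0 else undefined)"
      using PiE_mem[OF assms[unfolded cube_def], of i] PiE_arb[OF assms[unfolded cube_def], of i] by auto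
    then show "x i = char_vec V {i \<in> V. x i = 1} i"
      by (simp add: char_vec_def indicator_def split: if_splits)
  qed
qed auto

text \<open>Factorization bounds the marginal at \<open>S - neighbors E i\<close>, and
  supermodularity carries the bound up to \<open>S\<close>. The result is the recurrence of
  \<open>indep_poly_on\<close> at \<open>-p\<close>, with an inequality in place of
  equality.\<close>

lemma supermodular_factorizes_insert:
  assumes "supermodular V f" "factorizes V E p f" "i \<in> V" "S \<subseteq> V" "i \<notin> S"
  shows "set_fun V f (insert i S) \<ge> set_fun V f S - p i * set_fun V f (S - neighbors E i)"
proof -
  let ?T = "S - neighbors E i"
  have "marginal (set_fun V f) i ?T \<le> marginal (set_fun V f) i S"
    by (rule assms(1)[unfolded supermodular_def, rule_format]) (use assms in auto)
  moreover have "set_fun V f (?T \<union> {i}) \<ge> (1 - p i) * set_fun V f ?T"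
    by (rule assms(2)[unfolded factorizes_def, rule_format]) (use assms in auto)
  ultimately show ?thesis
    by (simp add: marginal_def algebra_simps)
qed

lemma indep_poly_ratio_mono:
  assumes G: "simple_graph V E"
    and p: "\<And>i. i \<in> V \<Longrightarrow> 0 \<le> p i"
    and pos: "\<And>S. S \<subseteq> V \<Longrightarrow> indep_poly_on V E (\<lambda>i. - p i) S > 0"
    and f: "supermodular V f" "factorizes V E p f"
    and "S \<subseteq> T" "T \<subseteq> V"
  shows "set_fun V f S * indep_poly_on V E (\<lambda>i. - p i) T
    \<le> set_fun V f T * indep_poly_on V E (\<lambda>i. - p i) S"
proof -
  let ?q = "indep_poly_on V E (\<lambda>i. - p i)" and ?F = "set_fun V f"
  have "finite T"
    using G \<open>T \<subseteq> V\<close> by (auto simp: simple_graph_def dest: finite_subset)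
  then show ?thesis
    using \<open>S \<subseteq> T\<close> \<open>T \<subseteq> V\<close>
  proof (induction T arbitrary: S rule: finite_psubset_induct)
    case (psubset T)
    show ?case
    proof (cases "S = T")
      case False
      with psubset.prems obtain i where i: "i \<in> T" "i \<notin> S" by blast
      define U where "U = T - {i}"
      have U: "U \<subset> T" "T = insert i U" "i \<notin> U" "S \<subseteq> U" "U \<subseteq> V" "i \<in> V"
        using i psubset.prems by (auto simp: U_def)
      let ?N = "U - neighbors E i"
      \<comment> \<open>The induction hypothesis for the pair \<open>?N\<close>, \<open>U\<close>
        controls the term subtracted in both recurrences.\<close>
      have "?F ?N * ?q U \<le> ?F U * ?q ?N"
        using U by (intro psubset.IH) auto
      then have "p i * (?F ?N * ?q U) \<le> p i * (?F U * ?q ?N)"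
        using p U by (intro mult_left_mono) auto
      moreover have "(?F U - p i * ?F ?N) * ?q U \<le> ?F T * ?q U"
        unfolding U(2) using U pos[of U] f
        by (intro mult_right_mono supermodular_factorizes_insert) auto
      moreover have "?F U * ?q T = ?F U * (?q U - p i * ?q ?N)"
        unfolding U(2) using indep_poly_on_insert[OF G U(6,3)] by simp
      ultimately have step: "?F U * ?q T \<le> ?F T * ?q U"
        by (simp add: algebra_simps)
      \<comment> \<open>Chain the ratio comparisons from \<open>S\<close> to \<open>U\<close> and
        from \<open>U\<close> to \<open>T\<close>; the positive factor \<open>?q U\<close> cancels
        at the end.\<close>
      have "(?F S * ?q U) * ?q T \<le> (?F U * ?q S) * ?q T"
        using U pos[OF psubset.prems(2)] by (intro mult_right_mono psubset.IH) auto
      also have "\<dots> = (?F U * ?q T) * ?q S"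
        by simp
      also have "\<dots> \<le> (?F T * ?q U) * ?q S"
        using step psubset.prems by (intro mult_right_mono less_imp_le[OF pos]) auto
      finally have "(?F S * ?q T) * ?q U \<le> (?F T * ?q S) * ?q U"
        by (simp add: ac_simps)
      then show ?thesis
        using pos[of U] U by (simp add: mult_le_cancel_right)
    qed simp
  qed
qed

section \<open>Nonnegative independence polynomials as supermodular functions; \<open>w\<close> will
  be the scaled vector \<open>t * p\<close>\<close>

context
  fixes V :: "'a set" and E :: "'a set set" and w :: "'a \<Rightarrow> real"
  assumes G: "simple_graph V E"
    and w: "\<And>i. i \<in> V \<Longrightarrow> 0 \<le> w i"
    and nonneg: "\<And>S. S \<subseteq> V \<Longrightarrow> 0 \<le> indep_poly_on V E (\<lambda>i. - w i) S"
begin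

text \<open>By the recurrence, each added vertex subtracts a product of two nonnegative
  numbers.\<close>

lemma indep_poly_on_antimono:
  assumes "S \<subseteq> T" "T \<subseteq> V"
  shows "indep_poly_on V E (\<lambda>i. - w i) T \<le> indep_poly_on V E (\<lambda>i. - w i) S"
proof -
  have "indep_poly_on V E (\<lambda>i. - w i) (S \<union> D) \<le> indep_poly_on V E (\<lambda>i. - w i) S"
    if "finite D" "S \<union> D \<subseteq> V" for D
    using that
  proof (induction D)
    case (insert i D)
    show ?case
    proof (cases "i \<in> S")
      case True
      then show ?thesis
        using insert by (simp add: insert_absorb)
    next
      case False
      have "0 \<le> w i * indep_poly_on V E (\<lambda>i. - w i) (S \<union> D - neighbors E i)"
        using insert.prems by (intro mult_nonneg_nonneg w nonneg) auto
      then show ?thesis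
        using insert indep_poly_on_insert[OF G, of i "S \<union> D"] False by simp
    qed
  qed simp
  from this[of T] show ?thesis
    using assms G by (auto simp: simple_graph_def Un_absorb1 dest: finite_subset)
qed

lemma set_fun_indep_poly:
  "S \<subseteq> V \<Longrightarrow> set_fun V (\<lambda>x. indep_poly V E (\<lambda>i. - (w i * x i))) S = indep_poly_on V E (\<lambda>i. - w i) S"
  using G unfolding set_fun_def
  by (intro indep_poly_indicator) (auto simp: simple_graph_def char_vec_def)

text \<open>By the recurrence, the marginal at \<open>U\<close> is \<open>- w i\<close> times the
  polynomial on \<open>U - neighbors E i\<close>, which decreases as \<open>U\<close> grows.\<close>

lemma supermodular_indep_poly: "supermodular V (\<lambda>x. indep_poly V E (\<lambda>i. - (w i * x i)))"
  unfolding supermodular_def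
proof (intro ballI allI impI, elim conjE)
  fix i S T assume i: "i \<in> V" and ST: "S \<subseteq> T" "T \<subseteq> V - {i}"
  have "marginal (set_fun V (\<lambda>x. indep_poly V E (\<lambda>i. - (w i * x i)))) i U
      = - (w i * indep_poly_on V E (\<lambda>i. - w i) (U - neighbors E i))" if "U \<subseteq> V - {i}" for U
  proof -
    have "U \<subseteq> V" "insert i U \<subseteq> V" "i \<notin> U"
      using that i by auto
    then show ?thesis
      using i indep_poly_on_insert[OF G, of i U "\<lambda>i. - w i"] by (simp add: marginal_def set_fun_indep_poly)
  qed
  moreover have "w i * indep_poly_on V E (\<lambda>i. - w i) (T - neighbors E i)
      \<le> w i * indep_poly_on V E (\<lambda>i. - w i) (S - neighbors E i)"
    using ST i by (intro mult_left_mono indep_poly_on_antimono w) auto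
  ultimately show "marginal (set_fun V (\<lambda>x. indep_poly V E (\<lambda>i. - (w i * x i)))) i S
      \<le> marginal (set_fun V (\<lambda>x. indep_poly V E (\<lambda>i. - (w i * x i)))) i T"
    using ST by auto
qed

text \<open>If \<open>S\<close> avoids the neighbors of \<open>i\<close>, the recurrence is
  multiplication by \<open>1 - w i\<close>, which is at least \<open>1 - p i\<close>.\<close>

lemma factorizes_indep_poly:
  assumes "\<And>i. i \<in> V \<Longrightarrow> w i \<le> p i"
  shows "factorizes V E p (\<lambda>x. indep_poly V E (\<lambda>i. - (w i * x i)))"
  unfolding factorizes_def
proof (intro ballI allI impI)
  fix i S assume i: "i \<in> V" and S: "S \<subseteq> V - (neighbors E i \<union> {i})"
  have *: "S \<subseteq> V" "insert i S \<subseteq> V" "i \<notin> S" "S - neighbors E i = S"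
    using i S by auto
  have "(1 - p i) * indep_poly_on V E (\<lambda>i. - w i) S \<le> (1 - w i) * indep_poly_on V E (\<lambda>i. - w i) S"
    using assms[OF i] * by (intro mult_right_mono nonneg) auto
  also have "\<dots> = indep_poly_on V E (\<lambda>i. - w i) (insert i S)"
    using indep_poly_on_insert[OF G i *(3), of "\<lambda>i. - w i"] *(4) by (simp add: algebra_simps)
  finally show "set_fun V (\<lambda>x. indep_poly V E (\<lambda>i. - (w i * x i))) (S \<union> {i})
      \<ge> (1 - p i) * set_fun V (\<lambda>x. indep_poly V E (\<lambda>i. - (w i * x i))) S"
    using * by (simp add: set_fun_indep_poly)
qed

end

section \<open>The critical scaling and the two parts of the theorem\<close>

lemma continuous_on_Min:
  fixes f :: "'i \<Rightarrow> 'a::topological_space \<Rightarrow> 'b::linorder_topology"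
  assumes "finite I" "I \<noteq> {}" "\<And>i. i \<in> I \<Longrightarrow> continuous_on A (f i)"
  shows "continuous_on A (\<lambda>x. Min ((\<lambda>i. f i x) ` I))"
  using assms by (induction I rule: finite_ne_induct) (auto intro!: continuous_on_min)

lemma exists_critical_scaling:
  assumes V: "finite V" and S: "S \<subseteq> V" "indep_poly_on V E (\<lambda>i. - p i) S < 0"
  obtains t T where "0 \<le> t" "t \<le> 1" "T \<subseteq> V" "indep_poly_on V E (\<lambda>i. - (t * p i)) T = 0"
    "\<And>U. U \<subseteq> V \<Longrightarrow> 0 \<le> indep_poly_on V E (\<lambda>i. - (t * p i)) U"
proof -
  define m where "m t = Min ((\<lambda>U. indep_poly_on V E (\<lambda>i. - (t * p i)) U) ` Pow V)" for t
  have cont: "continuous_on {0..1} m"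
    unfolding m_def indep_poly_on_def using V
    by (intro continuous_on_Min) (auto intro!: continuous_intros)
  have "indep_poly_on V E (\<lambda>i. - (0 * p i)) U \<ge> 0" for U
    unfolding indep_poly_on_def by (auto intro!: sum_nonneg prod_nonneg)
  then have "m 0 \<ge> 0"
    unfolding m_def using V by (subst Min_ge_iff) auto
  moreover have "m 1 \<le> 0"
    unfolding m_def using V S by (intro Min.coboundedI[THEN order_trans]) auto
  ultimately obtain t where t: "0 \<le> t" "t \<le> 1" "m t = 0"
    using IVT2'[OF _ _ _ cont] by auto
  \<comment> \<open>A minimum over finitely many subsets is attained; the minimizer is the set
    \<open>T\<close> where the polynomial vanishes.\<close>
  have "m t \<in> (\<lambda>U. indep_poly_on V E (\<lambda>i. - (t * p i)) U) ` Pow V"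
    unfolding m_def using V by (intro Min_in) auto
  then obtain T where "T \<subseteq> V" "indep_poly_on V E (\<lambda>i. - (t * p i)) T = 0"
    using t by auto
  moreover have "0 \<le> indep_poly_on V E (\<lambda>i. - (t * p i)) U" if "U \<subseteq> V" for U
    unfolding t(3)[symmetric] m_def using V that by (intro Min_le) auto
  ultimately show ?thesis
    using t that by blast
qed

theorem theorem5:
  fixes n :: nat and E :: "nat set set" and p :: "nat \<Rightarrow> real"
  assumes "simple_graph {1..n} E"
    and "\<forall>i\<in>{1..n}. 0 \<le> p i \<and> p i < 1"
  shows
    "((\<forall>S. S \<subseteq> {1..n} \<longrightarrow> indep_poly_on {1..n} E (\<lambda>i. - p i) S > 0) \<longrightarrow>
       (\<forall>f. f \<in> cube {1..n} \<rightarrow> {0..} \<and> supermodular {1..n} f \<and>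
            f (\<lambda>i\<in>{1..n}. 0) > 0 \<and> factorizes {1..n} E p f \<longrightarrow>
         (\<forall>x\<in>cube {1..n}.
            f x \<ge> f (\<lambda>i\<in>{1..n}. 0) * indep_poly {1..n} E (\<lambda>i. - p i * x i) \<and>
            f (\<lambda>i\<in>{1..n}. 0) * indep_poly {1..n} E (\<lambda>i. - p i * x i) > 0)))
     \<and>
     ((\<exists>S. S \<subseteq> {1..n} \<and> indep_poly_on {1..n} E (\<lambda>i. - p i) S < 0) \<longrightarrow>
       (\<exists>f. f \<in> cube {1..n} \<rightarrow> {0..} \<and> supermodular {1..n} f \<and>
            f (\<lambda>i\<in>{1..n}. 0) > 0 \<and> factorizes {1..n} E p f \<and>
            (\<exists>x\<in>cube {1..n}. f x = 0)))"
proof (intro conjI impI)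
  let ?V = "{1..n}"
  have zero: "(\<lambda>i\<in>?V. 0) = char_vec ?V {}"
    by (auto simp: char_vec_def)
  assume pos: "\<forall>S. S \<subseteq> ?V \<longrightarrow> indep_poly_on ?V E (\<lambda>i. - p i) S > 0"
  show "\<forall>f. f \<in> cube ?V \<rightarrow> {0..} \<and> supermodular ?V f \<and>
            f (\<lambda>i\<in>?V. 0) > 0 \<and> factorizes ?V E p f \<longrightarrow>
         (\<forall>x\<in>cube ?V.
            f x \<ge> f (\<lambda>i\<in>?V. 0) * indep_poly ?V E (\<lambda>i. - p i * x i) \<and>
            f (\<lambda>i\<in>?V. 0) * indep_poly ?V E (\<lambda>i. - p i * x i) > 0)"
  proof (intro allI impI ballI, elim conjE)
    fix f :: "(nat \<Rightarrow> real) \<Rightarrow> real" and x :: "nat \<Rightarrow> real"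
    assume f: "supermodular ?V f" "factorizes ?V E p f" and f0: "f (\<lambda>i\<in>?V. 0) > 0"
      and "x \<in> cube ?V"
    then obtain S where S: "S \<subseteq> ?V" "x = char_vec ?V S"
      using cube_eq_char_vec by blast
    have Z: "indep_poly ?V E (\<lambda>i. - p i * x i) = indep_poly_on ?V E (\<lambda>i. - p i) S"
      by (rule indep_poly_indicator) (auto simp: S char_vec_def)
    \<comment> \<open>Comparing with the empty set, where the polynomial is 1, turns the ratio
      inequality into the claimed bound.\<close>
    have "set_fun ?V f {} * indep_poly_on ?V E (\<lambda>i. - p i) S
        \<le> set_fun ?V f S * indep_poly_on ?V E (\<lambda>i. - p i) {}"
      using assms pos f S by (intro indep_poly_ratio_mono) auto
    then show "f x \<ge> f (\<lambda>i\<in>?V. 0) * indep_poly ?V E (\<lambda>i. - p i * x i) \<and>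
        f (\<lambda>i\<in>?V. 0) * indep_poly ?V E (\<lambda>i. - p i * x i) > 0"
      using pos S f0 unfolding Z zero set_fun_def by simp
  qed
next
  let ?V = "{1..n}"
  have zero: "(\<lambda>i\<in>?V. 0) = char_vec ?V {}"
    by (auto simp: char_vec_def)
  assume neg: "\<exists>S. S \<subseteq> ?V \<and> indep_poly_on ?V E (\<lambda>i. - p i) S < 0"
  show "\<exists>f. f \<in> cube ?V \<rightarrow> {0..} \<and> supermodular ?V f \<and>
            f (\<lambda>i\<in>?V. 0) > 0 \<and> factorizes ?V E p f \<and> (\<exists>x\<in>cube ?V. f x = 0)"
  proof -
    obtain S where S: "S \<subseteq> ?V" "indep_poly_on ?V E (\<lambda>i. - p i) S < 0"
      using neg by blast
    obtain t T where t: "0 \<le> t" "t \<le> 1"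
      and T: "T \<subseteq> ?V" "indep_poly_on ?V E (\<lambda>i. - (t * p i)) T = 0"
      and nonneg: "\<And>U. U \<subseteq> ?V \<Longrightarrow> 0 \<le> indep_poly_on ?V E (\<lambda>i. - (t * p i)) U"
      using exists_critical_scaling[OF finite_atLeastAtMost S] by blast
    \<comment> \<open>Since \<open>t \<le> 1\<close>, factorizing with the scaled weights implies
      factorizing with \<open>p\<close>.\<close>
    have w: "0 \<le> t * p i" "t * p i \<le> p i" if "i \<in> ?V" for i
      using assms(2) t that by (auto intro: mult_left_le_one_le)
    define f where "f x = indep_poly ?V E (\<lambda>i. - (t * p i * x i))" for x
    have f: "f (char_vec ?V U) = indep_poly_on ?V E (\<lambda>i. - (t * p i)) U" if "U \<subseteq> ?V" for U
      unfolding f_def by (rule indep_poly_indicator) (auto simp: char_vec_def)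
    have "f \<in> cube ?V \<rightarrow> {0..}"
      using f nonneg by (auto elim!: cube_eq_char_vec)
    moreover have "supermodular ?V f" "factorizes ?V E p f"
      unfolding f_def
      using supermodular_indep_poly[OF assms(1) w(1) nonneg]
        factorizes_indep_poly[OF assms(1) w(1) nonneg w(2)] by auto
    moreover have "f (\<lambda>i\<in>?V. 0) > 0"
      unfolding zero by (subst f) auto
    moreover have "f (char_vec ?V T) = 0"
      using T f by simp
    ultimately show ?thesis
      using char_vec_in_cube by blast
  qed
qed

end
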